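(* Let $C=\langle Tree,\unlhd,Choice\rangle$ be a stit frame for $Ag$. For every constant specification $\mathcal{CS}$, the following are equivalent: (i) for every $\mathcal{CS}$-normal jstit model $\mathcal{M}$ for $Ag$ based on $C$, every formula $A\in Form^{Ag}$ with $\vdash_{\mathcal{CS}}A$ satisfies $\mathcal{M}\models A$; (ii) $C$ is a mixed successor frame, i.e. $C\in\mathcal{C}^{Ag}_{mixsucc}$.
   Context: Language. $Ag$ is a fixed finite set (agents). $PVar$ (proof variables $x,y,z,\dots$), $PConst$ (proof constants $c,d,\dots$) and $Var$ (propositional variables $p,q,\dots$) are countably infinite; all these sets are pairwise disjoint. Proof polynomials $Pol$: $t:=x\mid c\mid s+t\mid s\times t\mid\, !t$. Formulas $Form^{Ag}$: $A:=p\mid A\wedge B\mid\neg A\mid[j]A\mid\Box A\mid t{:}A\mid KA\mid Et$ with $p\in Var$, $j\in Ag$, $t\in Pol$. Other Boolean connectives are the usual abbreviations; $\Diamond=\neg\Box\neg$. Frames. Let $Tree\neq\emptyset$ (moments) and let $\unlhd$ be a partial order on $Tree$ with irreflexive part $\lhd$. $Hist$ is the set of maximal $\unlhd$-chains (histories); $H_m=\{h\in Hist\mid m\in h\}$; $MH=\{(m,h)\mid m\in Tree,h\in H_m\}$. For $h,g\in H_m$, $h\approx_m g$ iff there is $m'\rhd m$ with $h,g\in H_{m'}$. $Next(m,m')$ means $m\lhd m'$ and $(\forall m''\lhd m')(m''\unlhd m)$. $\langle Tree,\unlhd\rangle$ is a temporal frame if: (1) $\forall m,m_1\exists m_2(m_2\unlhd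 m\wedge m_2\unlhd m_1)$; (2) $\forall m,m_1,m_2((m_1\unlhd m\wedge m_2\unlhd m)\Rightarrow(m_1\unlhd m_2\vee m_2\unlhd m_1))$. $\langle Tree,\unlhd,Choice\rangle$ is a stit frame for $Ag$ if moreover $Choice$ assigns to each $m\in Tree$, $j\in Ag$ a partition $Choice^m_j$ of $H_m$ ($Choice^m_j(h)$ is the cell containing $h$) such that (3) $h\approx_m h'$ implies $Choice^m_j(h)=Choice^m_j(h')$; (4) for every $m$ and every function $f$ on $Ag$ with $f(j)\in Choice^m_j$ for all $j$, $\bigcap_{j\in Ag}f(j)\neq\emptyset$. $\langle Tree,\unlhd,Choice,R,R_e\rangle$ is a jstit frame for $Ag$ if moreover $R,R_e$ are pre-orders on $Tree$ with $\unlhd\subseteq R\subseteq R_e$. (Equivalently, these frames are the corresponding reducts of the jstit models defined next.) Models. A jstit model for $Ag$ is $\mathcal{M}=\langle Tree,\unlhd,Choice,Act,R,R_e,\mathcal{E},V\rangle$ where $\langle Tree,\unlhd,Choice,R,R_e\rangle$ is a jstit frame for $Ag$, $Act:MH\to2^{Pol}$, $\mathcal{E}:Tree\times Pol\to2^{Form^{Ag}}$, $V:Var\to2^{MH}$, and, writing $Act_m=\bigcap_{h\in H_m}Act(m,h)$: - $R_e(m,m')\Rightarrow\mathcal{E}(m,t)\subseteq\mathcal{E}(m',t)$; - if $A\to B\in\mathcal{E}(m,s)$ and $A\in\mathcal{E}(m,t)$ then $B\in\mathcal{E}(m,s\times t)$; $\mathcal{E}(m,s)\cup\mathcal{E}(m,t)\subseteq\mathcal{E}(m,s+t)$;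 $A\in\mathcal{E}(m,t)\Rightarrow t{:}A\in\mathcal{E}(m,!t)$; - $m'\lhd m\Rightarrow\forall h\in H_m\,(Act(m',h)\subseteq Act(m,h))$; - $Act_m\subseteq\bigcup_{m'\lhd m,\,h\in H_m}Act(m',h)$; - for $h,h'\in H_m$: $h\approx_m h'\Rightarrow Act(m,h)=Act(m,h')$; - $R_e(m,m')\Rightarrow Act_m\subseteq Act_{m'}$. A model is based on each of its frame reducts (jstit, stit, temporal). Satisfaction at $(m,h)\in MH$: $p$ iff $(m,h)\in V(p)$; standard Boolean clauses; $[j]A$ iff $\mathcal{M},m,h'\models A$ for all $h'\in Choice^m_j(h)$; $\Box A$ iff $\mathcal{M},m,h'\models A$ for all $h'\in H_m$; $KA$ iff $\mathcal{M},m',h'\models A$ whenever $R(m,m')$ and $h'\in H_{m'}$; $t{:}A$ iff $A\in\mathcal{E}(m,t)$ and $\mathcal{M},m',h'\models A$ whenever $R_e(m,m')$ and $h'\in H_{m'}$; $Et$ iff $t\in Act(m,h)$. $\mathcal{M}\models A$ means $\mathcal{M},m,h\models A$ for all $(m,h)\in MH$. Axiom schemes: (A0) classical propositional axioms; (A1) S5 axioms for $\Box$ and each $[j]$; (A2) $\Box A\to[j]A$; (A3) $(\Diamond[j_1]A_1\wedge\dots\wedge\Diamond[j_n]A_n)\to\Diamond([j_1]A_1\wedge\dots\wedge[j_n]A_n)$ for pairwise different $j_1,\dots,j_n$; (A4) $s{:}(A\to B)\to(t{:}A\to(s\times t){:}B)$; (A5) $t{:}A\to(!t{:}(t{:}A)\wedge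 KA)$; (A6) $(s{:}A\vee t{:}A)\to(s+t){:}A$; (A7) S4 axioms for $K$; (A8) $KA\to\Box K\Box A$; (A9) $\Box Et\to K\Box Et$. A constant specification is a set $\mathcal{CS}\subseteq\{c_n{:}\dots c_1{:}A\mid c_1,\dots,c_n\in PConst,\ A\text{ an instance of (A0)--(A9)}\}$ such that $c_{n+1}{:}c_n{:}\dots c_1{:}A\in\mathcal{CS}$ implies $c_n{:}\dots c_1{:}A\in\mathcal{CS}$. A jstit model is $\mathcal{CS}$-normal iff $\{A\mid c{:}A\in\mathcal{CS}\}\subseteq\mathcal{E}(m,c)$ for all $c\in PConst$, $m\in Tree$. System $\Sigma_D(\mathcal{CS})$: axioms (A0)--(A9) and rules (R1) from $A$, $A\to B$ infer $B$; (R2) from $A$ infer $KA$; ($R_D$) from $KA\to(\neg\Box Et_1\vee\dots\vee\neg\Box Et_n\vee\Box Es_1\vee\dots\vee\Box Es_k)$ infer $KA\to(\neg Et_1\vee\dots\vee\neg Et_n\vee Es_1\vee\dots\vee Es_k)$, where $n,k\geq0$; ($R_{\mathcal{CS}}$) infer any member of $\mathcal{CS}$. $\vdash_{\mathcal{CS}}A$ means $A$ is provable in $\Sigma_D(\mathcal{CS})$ (there is a finite sequence ending in $A$, each member of which is an axiom or obtained by a rule from earlier members). Mixed successor. A (stit or temporal) frame is a mixed successor frame iff for all $m,m_1\in Tree$: $[m\lhd m_1\Rightarrow(\exists m_2\unlhd m_1)Next(m,m_2)]\vee[(\forall h,g\in H_m)(h\approx_m g)]$. $\mathcal{C}^{Ag}_{mixsucc}$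 is the class of mixed successor stit frames for $Ag$. *)

theory Defs
  imports Main "HOL-Library.Disjoint_Sets"
begin

datatype pol =
    PVar nat
  | PConst nat
  | PSum pol pol     (infixl \<open>\<^bold>+\<close> 95)
  | PTimes pol pol   (infixl \<open>\<^bold>\<times>\<close> 96)
  | PBang pol        (\<open>\<^bold>! _\<close> [98] 97)

text \<open>
  Formulas are typed over all potential agents; the set function \<open>agents\<close> of the datatype
  collects the agents that occur in a formula, and \<open>Form Ag\<close> is the language for the
  set of agents \<open>Ag\<close>, which may be any subset of the type.
\<close>

datatype (agents: 'ag) fm =
    Var nat
  | And "'ag fm" "'ag fm"   (infixr \<open>\<^bold>\<and>\<close> 75)
  | Neg "'ag fm"            (\<open>\<^bold>\<not> _\<close> [90] 90)
  | Stit 'ag "'ag fm"       (\<open>\<^bold>[_\<^bold>] _\<close> [0, 90] 90)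
  | Box "'ag fm"            (\<open>\<^bold>\<box> _\<close> [90] 90)
  | Just pol "'ag fm"       (infixr \<open>\<^bold>:\<close> 90)
  | Know "'ag fm"           (\<open>\<^bold>K _\<close> [90] 90)
  | Prv pol                 (\<open>\<^bold>E _\<close> [92] 91)

definition Form :: "'ag set \<Rightarrow> 'ag fm set" where
  "Form Ag = {A. agents A \<subseteq> Ag}"

abbreviation Imp :: "'ag fm \<Rightarrow> 'ag fm \<Rightarrow> 'ag fm" (infixr \<open>\<^bold>\<rightarrow>\<close> 65) where
  "A \<^bold>\<rightarrow> B \<equiv> \<^bold>\<not> (A \<^bold>\<and> \<^bold>\<not> B)"

abbreviation Or :: "'ag fm \<Rightarrow> 'ag fm \<Rightarrow> 'ag fm" (infixr \<open>\<^bold>\<or>\<close> 70) where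
  "A \<^bold>\<or> B \<equiv> \<^bold>\<not> (\<^bold>\<not> A \<^bold>\<and> \<^bold>\<not> B)"

abbreviation Dia :: "'ag fm \<Rightarrow> 'ag fm" (\<open>\<^bold>\<diamond> _\<close> [90] 90) where
  "\<^bold>\<diamond> A \<equiv> \<^bold>\<not> \<^bold>\<box> \<^bold>\<not> A"

definition Bot :: "'ag fm" where
  "Bot = Var 0 \<^bold>\<and> \<^bold>\<not> Var 0"

fun Conj :: "'ag fm list \<Rightarrow> 'ag fm" where
  "Conj [] = \<^bold>\<not> Bot"
| "Conj [A] = A"
| "Conj (A # B # As) = A \<^bold>\<and> Conj (B # As)"

fun Disj :: "'ag fm list \<Rightarrow> 'ag fm" where
  "Disj [] = Bot"
| "Disj [A] = A"
| "Disj (A # B # As) = A \<^bold>\<or> Disj (B # As)"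

type_synonym 'm history = "'m set"

text \<open>
  The type \<open>'m\<close> plays the role of the (nonempty) set of moments.  Since \<open>le\<close> is reflexive in
  every frame, the reflexive closure taken in the library's notion of chain has no effect.
\<close>

definition strict :: "'m rel \<Rightarrow> 'm rel" where
  "strict le = le - Id"

definition Hist :: "'m rel \<Rightarrow> 'm history set" where
  "Hist le = {h. pred_on.maxchain UNIV (\<lambda>m m'. (m, m') \<in> le) h}"

definition H :: "'m rel \<Rightarrow> 'm \<Rightarrow> 'm history set" where
  "H le m = {h \<in> Hist le. m \<in> h}"

definition MH :: "'m rel \<Rightarrow> ('m \<times> 'm history) set" where
  "MH le = {(m, h). h \<in> H le m}"

definition undivided :: "'m rel \<Rightarrow> 'm \<Rightarrow> 'm history \<Rightarrow> 'm history \<Rightarrow> bool" where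
  "undivided le m h g \<longleftrightarrow> (\<exists>m'. (m, m') \<in> strict le \<and> h \<in> H le m' \<and> g \<in> H le m')"

definition Next :: "'m rel \<Rightarrow> 'm \<Rightarrow> 'm \<Rightarrow> bool" where
  "Next le m m' \<longleftrightarrow>
     (m, m') \<in> strict le \<and> (\<forall>m''. (m'', m') \<in> strict le \<longrightarrow> (m'', m) \<in> le)"

definition is_temporal_frame :: "'m rel \<Rightarrow> bool" where
  "is_temporal_frame le \<longleftrightarrow>
     partial_order_on UNIV le \<and>
     (\<forall>m m1. \<exists>m2. (m2, m) \<in> le \<and> (m2, m1) \<in> le) \<and>
     (\<forall>m m1 m2. (m1, m) \<in> le \<and> (m2, m) \<in> le \<longrightarrow> (m1, m2) \<in> le \<or> (m2, m1) \<in> le)"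

definition mixed_successor :: "'m rel \<Rightarrow> bool" where
  "mixed_successor le \<longleftrightarrow>
     (\<forall>m m1.
        ((m, m1) \<in> strict le \<longrightarrow> (\<exists>m2. (m2, m1) \<in> le \<and> Next le m m2)) \<or>
        (\<forall>h \<in> H le m. \<forall>g \<in> H le m. undivided le m h g))"

record ('m, 'ag) stit_frame =
  Le :: "'m rel"
  Choice :: "'m \<Rightarrow> 'ag \<Rightarrow> 'm history set set"

definition cell ::
  "('m, 'ag, 'z) stit_frame_scheme \<Rightarrow> 'm \<Rightarrow> 'ag \<Rightarrow> 'm history \<Rightarrow> 'm history set" where
  "cell C m j h = (THE c. c \<in> Choice C m j \<and> h \<in> c)"

definition is_stit_frame :: "'ag set \<Rightarrow> ('m, 'ag, 'z) stit_frame_scheme \<Rightarrow> bool" where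
  "is_stit_frame Ag C \<longleftrightarrow>
     is_temporal_frame (Le C) \<and>
     (\<forall>m. \<forall>j \<in> Ag. partition_on (H (Le C) m) (Choice C m j)) \<and>
     (\<forall>m. \<forall>j \<in> Ag. \<forall>h \<in> H (Le C) m. \<forall>h' \<in> H (Le C) m.
        undivided (Le C) m h h' \<longrightarrow> cell C m j h = cell C m j h') \<and>
     (\<forall>m f. (\<forall>j \<in> Ag. f j \<in> Choice C m j) \<longrightarrow> (\<Inter>j \<in> Ag. f j) \<noteq> {})"

definition mixsucc_frames :: "'ag set \<Rightarrow> ('m, 'ag) stit_frame set" where
  "mixsucc_frames Ag = {C. is_stit_frame Ag C \<and> mixed_successor (Le C)}"

record ('m, 'ag) jstit_frame = "('m, 'ag) stit_frame" +
  R :: "'m rel"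
  Re :: "'m rel"

definition is_jstit_frame :: "'ag set \<Rightarrow> ('m, 'ag, 'z) jstit_frame_scheme \<Rightarrow> bool" where
  "is_jstit_frame Ag C \<longleftrightarrow>
     is_stit_frame Ag C \<and> preorder_on UNIV (R C) \<and> preorder_on UNIV (Re C) \<and>
     Le C \<subseteq> R C \<and> R C \<subseteq> Re C"

text \<open>The values of \<open>Act\<close> outside \<open>MH\<close> are irrelevant: no condition below refers to them.\<close>

record ('m, 'ag) jstit_model = "('m, 'ag) jstit_frame" +
  Act :: "'m \<Rightarrow> 'm history \<Rightarrow> pol set"
  Evid :: "'m \<Rightarrow> pol \<Rightarrow> 'ag fm set"
  Val :: "nat \<Rightarrow> ('m \<times> 'm history) set"

definition Act_all :: "('m, 'ag) jstit_model \<Rightarrow> 'm \<Rightarrow> pol set" where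
  "Act_all M m = (\<Inter>h \<in> H (Le M) m. Act M m h)"

definition is_jstit_model :: "'ag set \<Rightarrow> ('m, 'ag) jstit_model \<Rightarrow> bool" where
  "is_jstit_model Ag M \<longleftrightarrow>
     is_jstit_frame Ag M \<and>
     (\<forall>m t. Evid M m t \<subseteq> Form Ag) \<and>
     (\<forall>p. Val M p \<subseteq> MH (Le M)) \<and>
     (\<forall>m m' t. (m, m') \<in> Re M \<longrightarrow> Evid M m t \<subseteq> Evid M m' t) \<and>
     (\<forall>m s t A B. (A \<^bold>\<rightarrow> B) \<in> Evid M m s \<and> A \<in> Evid M m t \<longrightarrow> B \<in> Evid M m (s \<^bold>\<times> t)) \<and>
     (\<forall>m s t. Evid M m s \<union> Evid M m t \<subseteq> Evid M m (s \<^bold>+ t)) \<and>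
     (\<forall>m t A. A \<in> Evid M m t \<longrightarrow> (t \<^bold>: A) \<in> Evid M m (\<^bold>! t)) \<and>
     (\<forall>m m'. (m', m) \<in> strict (Le M) \<longrightarrow> (\<forall>h \<in> H (Le M) m. Act M m' h \<subseteq> Act M m h)) \<and>
     (\<forall>m. Act_all M m \<subseteq> (\<Union>m' \<in> {m'. (m', m) \<in> strict (Le M)}. \<Union>h \<in> H (Le M) m. Act M m' h)) \<and>
     (\<forall>m. \<forall>h \<in> H (Le M) m. \<forall>h' \<in> H (Le M) m.
        undivided (Le M) m h h' \<longrightarrow> Act M m h = Act M m h') \<and>
     (\<forall>m m'. (m, m') \<in> Re M \<longrightarrow> Act_all M m \<subseteq> Act_all M m')"

definition based_on :: "('m, 'ag) jstit_model \<Rightarrow> ('m, 'ag) stit_frame \<Rightarrow> bool" where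
  "based_on M C \<longleftrightarrow> stit_frame.truncate M = C"

primrec sat :: "('m, 'ag) jstit_model \<Rightarrow> 'm \<Rightarrow> 'm history \<Rightarrow> 'ag fm \<Rightarrow> bool" where
  "sat M m h (Var p) \<longleftrightarrow> (m, h) \<in> Val M p"
| "sat M m h (A \<^bold>\<and> B) \<longleftrightarrow> sat M m h A \<and> sat M m h B"
| "sat M m h (\<^bold>\<not> A) \<longleftrightarrow> \<not> sat M m h A"
| "sat M m h (\<^bold>[j\<^bold>] A) \<longleftrightarrow> (\<forall>h' \<in> cell M m j h. sat M m h' A)"
| "sat M m h (\<^bold>\<box> A) \<longleftrightarrow> (\<forall>h' \<in> H (Le M) m. sat M m h' A)"
| "sat M m h (t \<^bold>: A) \<longleftrightarrow> A \<in> Evid M m t \<and>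
     (\<forall>m' h'. (m, m') \<in> Re M \<and> h' \<in> H (Le M) m' \<longrightarrow> sat M m' h' A)"
| "sat M m h (\<^bold>K A) \<longleftrightarrow> (\<forall>m' h'. (m, m') \<in> R M \<and> h' \<in> H (Le M) m' \<longrightarrow> sat M m' h' A)"
| "sat M m h (\<^bold>E t) \<longleftrightarrow> t \<in> Act M m h"

definition valid_in :: "('m, 'ag) jstit_model \<Rightarrow> 'ag fm \<Rightarrow> bool" where
  "valid_in M A \<longleftrightarrow> (\<forall>(m, h) \<in> MH (Le M). sat M m h A)"

text \<open>
  All instances of tautologies are taken as classical propositional axioms, i.e. the formulas
  that are true under every assignment of truth values to the subformulas that are not of the form
  \<open>A \<^bold>\<and> B\<close> or \<open>\<^bold>\<not> A\<close>.
\<close>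

fun peval :: "('ag fm \<Rightarrow> bool) \<Rightarrow> 'ag fm \<Rightarrow> bool" where
  "peval v (A \<^bold>\<and> B) \<longleftrightarrow> peval v A \<and> peval v B"
| "peval v (\<^bold>\<not> A) \<longleftrightarrow> \<not> peval v A"
| "peval v A \<longleftrightarrow> v A"

definition tautology :: "'ag fm \<Rightarrow> bool" where
  "tautology A \<longleftrightarrow> (\<forall>v. peval v A)"

inductive scheme_instance :: "'ag fm \<Rightarrow> bool" where
  A0: "tautology A \<Longrightarrow> scheme_instance A"
| A1_Box_K: "scheme_instance (\<^bold>\<box> (A \<^bold>\<rightarrow> B) \<^bold>\<rightarrow> \<^bold>\<box> A \<^bold>\<rightarrow> \<^bold>\<box> B)"
| A1_Box_T: "scheme_instance (\<^bold>\<box> A \<^bold>\<rightarrow> A)"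
| A1_Box_4: "scheme_instance (\<^bold>\<box> A \<^bold>\<rightarrow> \<^bold>\<box> \<^bold>\<box> A)"
| A1_Box_5: "scheme_instance (\<^bold>\<diamond> A \<^bold>\<rightarrow> \<^bold>\<box> \<^bold>\<diamond> A)"
| A1_Stit_K: "scheme_instance (\<^bold>[j\<^bold>] (A \<^bold>\<rightarrow> B) \<^bold>\<rightarrow> \<^bold>[j\<^bold>] A \<^bold>\<rightarrow> \<^bold>[j\<^bold>] B)"
| A1_Stit_T: "scheme_instance (\<^bold>[j\<^bold>] A \<^bold>\<rightarrow> A)"
| A1_Stit_4: "scheme_instance (\<^bold>[j\<^bold>] A \<^bold>\<rightarrow> \<^bold>[j\<^bold>] \<^bold>[j\<^bold>] A)"
| A1_Stit_5: "scheme_instance (\<^bold>\<not> \<^bold>[j\<^bold>] \<^bold>\<not> A \<^bold>\<rightarrow> \<^bold>[j\<^bold>] \<^bold>\<not> \<^bold>[j\<^bold>] \<^bold>\<not> A)"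
| A2: "scheme_instance (\<^bold>\<box> A \<^bold>\<rightarrow> \<^bold>[j\<^bold>] A)"
| A3: "jAs \<noteq> [] \<Longrightarrow> distinct (map fst jAs) \<Longrightarrow>
    scheme_instance (Conj (map (\<lambda>(j, A). \<^bold>\<diamond> \<^bold>[j\<^bold>] A) jAs) \<^bold>\<rightarrow> \<^bold>\<diamond> Conj (map (\<lambda>(j, A). \<^bold>[j\<^bold>] A) jAs))"
| A4: "scheme_instance (s \<^bold>: (A \<^bold>\<rightarrow> B) \<^bold>\<rightarrow> t \<^bold>: A \<^bold>\<rightarrow> (s \<^bold>\<times> t) \<^bold>: B)"
| A5: "scheme_instance (t \<^bold>: A \<^bold>\<rightarrow> ((\<^bold>! t) \<^bold>: (t \<^bold>: A) \<^bold>\<and> \<^bold>K A))"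
| A6: "scheme_instance ((s \<^bold>: A \<^bold>\<or> t \<^bold>: A) \<^bold>\<rightarrow> (s \<^bold>+ t) \<^bold>: A)"
| A7_K: "scheme_instance (\<^bold>K (A \<^bold>\<rightarrow> B) \<^bold>\<rightarrow> \<^bold>K A \<^bold>\<rightarrow> \<^bold>K B)"
| A7_T: "scheme_instance (\<^bold>K A \<^bold>\<rightarrow> A)"
| A7_4: "scheme_instance (\<^bold>K A \<^bold>\<rightarrow> \<^bold>K \<^bold>K A)"
| A8: "scheme_instance (\<^bold>K A \<^bold>\<rightarrow> \<^bold>\<box> \<^bold>K \<^bold>\<box> A)"
| A9: "scheme_instance (\<^bold>\<box> \<^bold>E t \<^bold>\<rightarrow> \<^bold>K \<^bold>\<box> \<^bold>E t)"

definition axioms :: "'ag set \<Rightarrow> 'ag fm set" where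
  "axioms Ag = {A \<in> Form Ag. scheme_instance A}"

text \<open>\<open>consts_just [c\<^sub>n, \<dots>, c\<^sub>1] A\<close> is \<open>c\<^sub>n : \<dots> c\<^sub>1 : A\<close>.\<close>

definition consts_just :: "nat list \<Rightarrow> 'ag fm \<Rightarrow> 'ag fm" where
  "consts_just cs A = foldr (\<lambda>c B. PConst c \<^bold>: B) cs A"

definition constant_specification :: "'ag set \<Rightarrow> 'ag fm set \<Rightarrow> bool" where
  "constant_specification Ag CS \<longleftrightarrow>
     CS \<subseteq> {consts_just cs A | cs A. cs \<noteq> [] \<and> A \<in> axioms Ag} \<and>
     (\<forall>c cs A. cs \<noteq> [] \<and> A \<in> axioms Ag \<and> consts_just (c # cs) A \<in> CS \<longrightarrow> consts_just cs A \<in> CS)"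

definition normal :: "'ag fm set \<Rightarrow> ('m, 'ag) jstit_model \<Rightarrow> bool" where
  "normal CS M \<longleftrightarrow> (\<forall>c m. {A. (PConst c \<^bold>: A) \<in> CS} \<subseteq> Evid M m (PConst c))"

text \<open>
  The side formulas \<open>A\<close> and \<open>B\<close> of the rules need no restriction to \<open>Form Ag\<close>: if \<open>CS\<close> is a
  constant specification for \<open>Ag\<close>, the rules lead from formulas in \<open>Form Ag\<close> only to such formulas.
\<close>

inductive provable :: "'ag set \<Rightarrow> 'ag fm set \<Rightarrow> 'ag fm \<Rightarrow> bool"
  for Ag :: "'ag set" and CS :: "'ag fm set"
where
  Ax: "A \<in> axioms Ag \<Longrightarrow> provable Ag CS A"
| R1: "provable Ag CS A \<Longrightarrow> provable Ag CS (A \<^bold>\<rightarrow> B) \<Longrightarrow> provable Ag CS B"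
| R2: "provable Ag CS A \<Longrightarrow> provable Ag CS (\<^bold>K A)"
| RD: "provable Ag CS
         (\<^bold>K A \<^bold>\<rightarrow> Disj (map (\<lambda>t. \<^bold>\<not> \<^bold>\<box> \<^bold>E t) ts @ map (\<lambda>s. \<^bold>\<box> \<^bold>E s) ss)) \<Longrightarrow>
       provable Ag CS
         (\<^bold>K A \<^bold>\<rightarrow> Disj (map (\<lambda>t. \<^bold>\<not> \<^bold>E t) ts @ map (\<lambda>s. \<^bold>E s) ss))"
| RCS: "A \<in> CS \<Longrightarrow> provable Ag CS A"

end

theory Submission
  imports Defs
begin

text \<open>
  Rule \<open>RD\<close> is the only point at which soundness depends on the shape of the frame: every other
  rule preserves validity, and every axiom holds, in all models that are normal for the constant
  specification.

  In a mixed successor frame the rule is sound because a failure of its conclusion can be turned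
  into a failure of its premise.  Let \<open>Et\<^sub>i\<close> hold and \<open>Es\<^sub>k\<close> fail at \<open>(m, h)\<close>.  If no branching takes
  place at \<open>m\<close>, then \<open>Act\<close> is constant on the histories through \<open>m\<close>, and the premise fails at
  \<open>(m, h)\<close>.  Otherwise \<open>m\<close> has an immediate successor \<open>m'\<close> on \<open>h\<close> (or is maximal, and then \<open>h\<close> is its
  only history).  The histories through \<open>m'\<close> are pairwise undivided at \<open>m\<close>, so all of them carry
  \<open>t\<^sub>i\<close>; and \<open>s\<^sub>k\<close> cannot be common to them, since a proof common to all histories at \<open>m'\<close> must have
  been presented strictly before \<open>m'\<close>, that is, not later than \<open>m\<close>.  So the premise fails at \<open>m'\<close>.
  This is lemma \<open>RD_sound\<close>.

  Conversely, let \<open>m \<lhd> m1\<close> with no immediate successor of \<open>m\<close> below \<open>m1\<close>, and let some two histories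
  be divided at \<open>m\<close>.  From \<open>K(\<box>Et \<rightarrow> \<box>Es) \<rightarrow> (\<box>Et \<rightarrow> \<box>Es)\<close>, an instance of reflexivity for \<open>K\<close>,
  rule \<open>RD\<close> yields the theorem \<open>K(\<box>Et \<rightarrow> \<box>Es) \<rightarrow> (Et \<rightarrow> Es)\<close>.  It is refuted by presenting \<open>t\<close>
  from \<open>m\<close> onwards, and \<open>s\<close> strictly after \<open>m\<close>, exactly on the histories that leave \<open>m\<close> in the
  direction of \<open>m1\<close>.  At \<open>m\<close> itself \<open>t\<close> is not common to all histories, because of the branching;
  strictly after \<open>m\<close> the two proofs are presented together; and \<open>s\<close> is always presented at an
  earlier moment before it becomes common to all histories, because there is no first moment after
  \<open>m\<close> in the direction of \<open>m1\<close>.  This is the model \<open>counter_model\<close>; its evidence function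
  admits everything, so that it is normal for every constant specification.
\<close>

section \<open>Histories in temporal frames\<close>

lemma temporal_frameD:
  assumes "is_temporal_frame le"
  shows temporal_refl: "(m, m) \<in> le"
    and temporal_trans: "(a, b) \<in> le \<Longrightarrow> (b, c) \<in> le \<Longrightarrow> (a, c) \<in> le"
    and temporal_antisym: "(a, b) \<in> le \<Longrightarrow> (b, a) \<in> le \<Longrightarrow> a = b"
    and temporal_linear_below: "(a, m) \<in> le \<Longrightarrow> (b, m) \<in> le \<Longrightarrow> (a, b) \<in> le \<or> (b, a) \<in> le"
proof -
  have le: "refl le" "trans le" "antisym le"
    and linear: "\<forall>m m1 m2. (m1, m) \<in> le \<and> (m2, m) \<in> le \<longrightarrow> (m1, m2) \<in> le \<or> (m2, m1) \<in> le"
    using assms unfolding is_temporal_frame_def partial_order_on_def preorder_on_def by simp_all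
  show "(m, m) \<in> le" using reflD[OF le(1)] .
  show "(a, b) \<in> le \<Longrightarrow> (b, c) \<in> le \<Longrightarrow> (a, c) \<in> le" using transD[OF le(2)] .
  show "(a, b) \<in> le \<Longrightarrow> (b, a) \<in> le \<Longrightarrow> a = b" using antisymD[OF le(3)] .
  show "(a, m) \<in> le \<Longrightarrow> (b, m) \<in> le \<Longrightarrow> (a, b) \<in> le \<or> (b, a) \<in> le" using linear by simp
qed

lemma chain_iff:
  assumes T: "is_temporal_frame le"
  shows "pred_on.chain A (\<lambda>m m'. (m, m') \<in> le) h \<longleftrightarrow>
    h \<subseteq> A \<and> (\<forall>a \<in> h. \<forall>b \<in> h. (a, b) \<in> le \<or> (b, a) \<in> le)"
  unfolding pred_on.chain_def using temporal_refl[OF T] by (simp; metis)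

lemma history_comparable:
  assumes T: "is_temporal_frame le" and "h \<in> Hist le" "a \<in> h" "b \<in> h"
  shows "(a, b) \<in> le \<or> (b, a) \<in> le"
  using assms(2-) unfolding Hist_def pred_on.maxchain_def by (auto simp: chain_iff[OF T])

lemma history_maximal:
  assumes T: "is_temporal_frame le" and h: "h \<in> Hist le"
    and comparable: "\<And>b. b \<in> h \<Longrightarrow> (a, b) \<in> le \<or> (b, a) \<in> le"
  shows "a \<in> h"
proof (rule ccontr)
  assume "a \<notin> h"
  have "pred_on.chain UNIV (\<lambda>m m'. (m, m') \<in> le) (insert a h)"
    using history_comparable[OF T h] comparable temporal_refl[OF T] by (auto simp: chain_iff[OF T])
  with \<open>a \<notin> h\<close> h show False
    unfolding Hist_def pred_on.maxchain_def by auto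
qed

lemma history_downward_closed:
  assumes T: "is_temporal_frame le" and h: "h \<in> Hist le" and "b \<in> h" "(a, b) \<in> le"
  shows "a \<in> h"
proof (rule history_maximal[OF T h])
  fix x assume "x \<in> h"
  then have "(x, b) \<in> le \<or> (b, x) \<in> le"
    using history_comparable[OF T h] \<open>b \<in> h\<close> by blast
  then show "(a, x) \<in> le \<or> (x, a) \<in> le"
    using temporal_linear_below[OF T \<open>(a, b) \<in> le\<close>, of x] temporal_trans[OF T \<open>(a, b) \<in> le\<close>, of x]
    by blast
qed

lemma H_antimono: "is_temporal_frame le \<Longrightarrow> (a, b) \<in> le \<Longrightarrow> h \<in> H le b \<Longrightarrow> h \<in> H le a"
  unfolding H_def by (auto intro: history_downward_closed)

text \<open>
  Hausdorff's maximal principle, applied to the moments comparable with \<open>m\<close>: a maximal chain among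
  these contains \<open>m\<close>, and every chain that contains \<open>m\<close> consists of such moments.
\<close>

lemma H_nonempty:
  assumes T: "is_temporal_frame le"
  shows "H le m \<noteq> {}"
proof -
  let ?P = "\<lambda>m m'. (m, m') \<in> le"
  let ?A = "{x. (x, m) \<in> le \<or> (m, x) \<in> le}"
  obtain h where h: "pred_on.maxchain ?A ?P h"
    using pred_on.Hausdorff by blast
  then have chain: "pred_on.chain ?A ?P h"
    and max: "\<And>S. pred_on.chain ?A ?P S \<Longrightarrow> \<not> h \<subset> S"
    unfolding pred_on.maxchain_def by auto
  have "pred_on.chain ?A ?P (insert m h)"
    using chain temporal_refl[OF T] unfolding chain_iff[OF T] by auto
  then have "m \<in> h"
    using max by blast
  have "pred_on.chain ?A ?P S" if "pred_on.chain UNIV ?P S" "h \<subset> S" for S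
    using that \<open>m \<in> h\<close> unfolding chain_iff[OF T] by blast
  moreover have "pred_on.chain UNIV ?P h"
    using chain unfolding chain_iff[OF T] by blast
  ultimately have "pred_on.maxchain UNIV ?P h"
    using max unfolding pred_on.maxchain_def by blast
  with \<open>m \<in> h\<close> have "h \<in> H le m"
    unfolding H_def Hist_def by auto
  then show ?thesis by auto
qed

lemma history_proceeds:
  assumes T: "is_temporal_frame le" and m1: "(m, m1) \<in> strict le" and h: "h \<in> H le m"
  obtains m' where "(m, m') \<in> strict le" "m' \<in> h"
proof (rule ccontr)
  assume "\<not> thesis"
  with that have none: "(m, b) \<notin> strict le" if "b \<in> h" for b
    using \<open>b \<in> h\<close> by blast
  have "(b, m) \<in> le" if "b \<in> h" for b
    using history_comparable[OF T] h none[OF that] that temporal_refl[OF T]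
    unfolding H_def strict_def by blast
  then have "m1 \<in> h"
    using history_maximal[OF T, of h m1] temporal_trans[OF T, of _ m m1] h m1
    unfolding H_def strict_def by blast
  with none m1 show False by blast
qed

section \<open>Soundness of the axioms\<close>

lemma sat_Bot [simp]: "\<not> sat M m h Bot"
  by (simp add: Bot_def)

lemma sat_Conj [simp]: "sat M m h (Conj As) \<longleftrightarrow> (\<forall>A \<in> set As. sat M m h A)"
  by (induction As rule: Conj.induct) auto

lemma sat_Disj [simp]: "sat M m h (Disj As) \<longleftrightarrow> (\<exists>A \<in> set As. sat M m h A)"
  by (induction As rule: Disj.induct) auto

lemma valid_in_iff: "valid_in M A \<longleftrightarrow> (\<forall>m. \<forall>h \<in> H (Le M) m. sat M m h A)"
  unfolding valid_in_def MH_def by auto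

lemma peval_sat: "peval (sat M m h) A \<longleftrightarrow> sat M m h A"
  by (induction A) auto

lemma agents_Conj: "agents (Conj As) = (\<Union>A \<in> set As. agents A)"
  by (induction As rule: Conj.induct) (auto simp: Bot_def)

lemma stit_frameD:
  assumes "is_stit_frame Ag C"
  shows stit_temporal: "is_temporal_frame (Le C)"
    and stit_partition: "j \<in> Ag \<Longrightarrow> partition_on (H (Le C) m) (Choice C m j)"
    and stit_independence: "(\<forall>j \<in> Ag. f j \<in> Choice C m j) \<Longrightarrow> (\<Inter>j \<in> Ag. f j) \<noteq> {}"
  using assms unfolding is_stit_frame_def by simp_all

lemma cell_eqI:
  assumes C: "is_stit_frame Ag C" "j \<in> Ag" and c: "c \<in> Choice C m j" "h \<in> c"
  shows "cell C m j h = c"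
  unfolding cell_def
proof (rule the_equality)
  show "d = c" if "d \<in> Choice C m j \<and> h \<in> d" for d
    using partition_onD2[OF stit_partition[OF C]] that c unfolding disjoint_def by blast
qed (use c in simp)

lemma cell_in_Choice:
  assumes "is_stit_frame Ag C" "j \<in> Ag" "h \<in> H (Le C) m"
  shows "cell C m j h \<in> Choice C m j" "h \<in> cell C m j h" "cell C m j h \<subseteq> H (Le C) m"
proof -
  have P: "partition_on (H (Le C) m) (Choice C m j)"
    using stit_partition[OF assms(1,2)] .
  then obtain c where "c \<in> Choice C m j" "h \<in> c"
    using assms(3) unfolding partition_on_def by blast
  moreover then have "cell C m j h = c"
    using cell_eqI[OF assms(1,2)] by blast
  ultimately show "cell C m j h \<in> Choice C m j" "h \<in> cell C m j h" "cell C m j h \<subseteq> H (Le C) m"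
    using P unfolding partition_on_def by auto
qed

lemma cell_eq:
  assumes "is_stit_frame Ag C" "j \<in> Ag" "h \<in> H (Le C) m" "h' \<in> cell C m j h"
  shows "cell C m j h' = cell C m j h"
  using cell_eqI[OF assms(1,2)] cell_in_Choice[OF assms(1-3)] assms(4) by blast

text \<open>
  Each agent picks the cell of a history \<open>w j\<close> on which its own demand is met, an agent without a
  demand any cell at all.  Independence of agents puts some history into all these cells, and there
  every demand is met, since \<open>[j]\<close> depends on the cell only.
\<close>

lemma independence_sound:
  assumes C: "is_stit_frame Ag M" and m: "h \<in> H (Le M) m"
    and jAs: "jAs \<noteq> []" "distinct (map fst jAs)" "fst ` set jAs \<subseteq> Ag"
    and possible: "\<And>j A. (j, A) \<in> set jAs \<Longrightarrow> \<exists>h \<in> H (Le M) m. sat M m h (\<^bold>[j\<^bold>] A)"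
  shows "\<exists>h \<in> H (Le M) m. \<forall>(j, A) \<in> set jAs. sat M m h (\<^bold>[j\<^bold>] A)"
proof -
  have "\<exists>k \<in> H (Le M) m. \<forall>A. (j, A) \<in> set jAs \<longrightarrow> sat M m k (\<^bold>[j\<^bold>] A)" for j
  proof (cases "\<exists>A. (j, A) \<in> set jAs")
    case True
    then obtain A where A: "(j, A) \<in> set jAs" by blast
    \<comment> \<open>Since the agents are pairwise different, \<open>A\<close> is the only demand made on \<open>j\<close>.\<close>
    have "B = A" if "(j, B) \<in> set jAs" for B
      using eq_key_imp_eq_value[OF jAs(2)] that A by metis
    with possible[OF A] show ?thesis by blast
  next
    case False
    with m show ?thesis by blast
  qed
  then obtain w where w: "\<And>j. w j \<in> H (Le M) m"
    "\<And>j A. (j, A) \<in> set jAs \<Longrightarrow> sat M m (w j) (\<^bold>[j\<^bold>] A)"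
    by metis
  have "(\<Inter>j \<in> Ag. cell M m j (w j)) \<noteq> {}"
    using stit_independence[OF C, where f = "\<lambda>j. cell M m j (w j)"] cell_in_Choice(1)[OF C _ w(1)]
    by blast
  then obtain k where k: "\<And>j. j \<in> Ag \<Longrightarrow> k \<in> cell M m j (w j)" by blast
  obtain j0 where "j0 \<in> Ag" using jAs(1,3) by (cases jAs) auto
  then have "k \<in> H (Le M) m"
    using k cell_in_Choice(3)[OF C _ w(1)] by blast
  moreover have "sat M m k (\<^bold>[j\<^bold>] A)" if "(j, A) \<in> set jAs" for j A
  proof -
    have "j \<in> Ag" using that jAs(3) by force
    then show ?thesis
      using w(2)[OF that] cell_eq[OF C \<open>j \<in> Ag\<close> w(1) k[OF \<open>j \<in> Ag\<close>]] by simp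
  qed
  ultimately show ?thesis by blast
qed

lemma jstit_modelD:
  assumes "is_jstit_model Ag M"
  shows jstit_stit: "is_stit_frame Ag M"
    and jstit_R_refl: "(a, a) \<in> R M"
    and jstit_R_trans: "(a, b) \<in> R M \<Longrightarrow> (b, c) \<in> R M \<Longrightarrow> (a, c) \<in> R M"
    and jstit_Re_trans: "(a, b) \<in> Re M \<Longrightarrow> (b, c) \<in> Re M \<Longrightarrow> (a, c) \<in> Re M"
    and jstit_Le_R: "(a, b) \<in> Le M \<Longrightarrow> (a, b) \<in> R M"
    and jstit_R_Re: "(a, b) \<in> R M \<Longrightarrow> (a, b) \<in> Re M"
proof -
  have frame: "is_jstit_frame Ag M"
    using assms unfolding is_jstit_model_def by (elim conjE)
  then show "is_stit_frame Ag M"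
    unfolding is_jstit_frame_def by (elim conjE)
  have "refl (R M)" "trans (R M)" "trans (Re M)" "Le M \<subseteq> R M" "R M \<subseteq> Re M"
    using frame unfolding is_jstit_frame_def preorder_on_def by simp_all
  then show "(a, a) \<in> R M"
    "(a, b) \<in> R M \<Longrightarrow> (b, c) \<in> R M \<Longrightarrow> (a, c) \<in> R M"
    "(a, b) \<in> Re M \<Longrightarrow> (b, c) \<in> Re M \<Longrightarrow> (a, c) \<in> Re M"
    "(a, b) \<in> Le M \<Longrightarrow> (a, b) \<in> R M"
    "(a, b) \<in> R M \<Longrightarrow> (a, b) \<in> Re M"
    by (blast dest: reflD transD)+
qed

lemma jstit_model_EvidD:
  assumes "is_jstit_model Ag M"
  shows jstit_Evid_mono: "(a, b) \<in> Re M \<Longrightarrow> A \<in> Evid M a t \<Longrightarrow> A \<in> Evid M b t"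
    and jstit_Evid_times:
      "(A \<^bold>\<rightarrow> B) \<in> Evid M a s \<Longrightarrow> A \<in> Evid M a t \<Longrightarrow> B \<in> Evid M a (s \<^bold>\<times> t)"
    and jstit_Evid_plus: "A \<in> Evid M a s \<union> Evid M a t \<Longrightarrow> A \<in> Evid M a (s \<^bold>+ t)"
    and jstit_Evid_bang: "A \<in> Evid M a t \<Longrightarrow> (t \<^bold>: A) \<in> Evid M a (\<^bold>! t)"
proof -
  have mono: "\<forall>m m' t. (m, m') \<in> Re M \<longrightarrow> Evid M m t \<subseteq> Evid M m' t"
    using assms unfolding is_jstit_model_def by (elim conjE)
  show "(a, b) \<in> Re M \<Longrightarrow> A \<in> Evid M a t \<Longrightarrow> A \<in> Evid M b t"
    using mono by blast
  have "\<forall>m s t A B. (A \<^bold>\<rightarrow> B) \<in> Evid M m s \<and> A \<in> Evid M m t \<longrightarrow> B \<in> Evid M m (s \<^bold>\<times> t)"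
    using assms unfolding is_jstit_model_def by (elim conjE)
  then show "(A \<^bold>\<rightarrow> B) \<in> Evid M a s \<Longrightarrow> A \<in> Evid M a t \<Longrightarrow> B \<in> Evid M a (s \<^bold>\<times> t)"
    by blast
  have "\<forall>m s t. Evid M m s \<union> Evid M m t \<subseteq> Evid M m (s \<^bold>+ t)"
    using assms unfolding is_jstit_model_def by (elim conjE)
  then show "A \<in> Evid M a s \<union> Evid M a t \<Longrightarrow> A \<in> Evid M a (s \<^bold>+ t)"
    by blast
  have "\<forall>m t A. A \<in> Evid M m t \<longrightarrow> (t \<^bold>: A) \<in> Evid M m (\<^bold>! t)"
    using assms unfolding is_jstit_model_def by (elim conjE)
  then show "A \<in> Evid M a t \<Longrightarrow> (t \<^bold>: A) \<in> Evid M a (\<^bold>! t)"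
    by blast
qed

lemma jstit_model_ActD:
  assumes "is_jstit_model Ag M"
  shows jstit_Act_mono: "(a, b) \<in> Le M \<Longrightarrow> h \<in> H (Le M) b \<Longrightarrow> Act M a h \<subseteq> Act M b h"
    and jstit_Act_no_new: "Act_all M b \<subseteq>
      (\<Union>a \<in> {a. (a, b) \<in> strict (Le M)}. \<Union>h \<in> H (Le M) b. Act M a h)"
    and jstit_Act_undivided: "undivided (Le M) a h g \<Longrightarrow> h \<in> H (Le M) a \<Longrightarrow> g \<in> H (Le M) a \<Longrightarrow>
      Act M a h = Act M a g"
    and jstit_Act_all_mono: "(a, b) \<in> Re M \<Longrightarrow> Act_all M a \<subseteq> Act_all M b"
proof -
  have mono: "\<forall>m m'. (m', m) \<in> strict (Le M) \<longrightarrow> (\<forall>h \<in> H (Le M) m. Act M m' h \<subseteq> Act M m h)"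
    using assms unfolding is_jstit_model_def by (elim conjE)
  show "(a, b) \<in> Le M \<Longrightarrow> h \<in> H (Le M) b \<Longrightarrow> Act M a h \<subseteq> Act M b h"
    using mono unfolding strict_def by (cases "a = b") auto
  have "\<forall>m. Act_all M m \<subseteq>
      (\<Union>m' \<in> {m'. (m', m) \<in> strict (Le M)}. \<Union>h \<in> H (Le M) m. Act M m' h)"
    using assms unfolding is_jstit_model_def by (elim conjE)
  then show "Act_all M b \<subseteq> (\<Union>a \<in> {a. (a, b) \<in> strict (Le M)}. \<Union>h \<in> H (Le M) b. Act M a h)"
    by (rule spec)
  have "\<forall>m. \<forall>h \<in> H (Le M) m. \<forall>h' \<in> H (Le M) m.
      undivided (Le M) m h h' \<longrightarrow> Act M m h = Act M m h'"
    using assms unfolding is_jstit_model_def by (elim conjE)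
  then show "undivided (Le M) a h g \<Longrightarrow> h \<in> H (Le M) a \<Longrightarrow> g \<in> H (Le M) a \<Longrightarrow>
      Act M a h = Act M a g"
    by blast
  have "\<forall>m m'. (m, m') \<in> Re M \<longrightarrow> Act_all M m \<subseteq> Act_all M m'"
    using assms unfolding is_jstit_model_def by (elim conjE)
  then show "(a, b) \<in> Re M \<Longrightarrow> Act_all M a \<subseteq> Act_all M b"
    by blast
qed

lemma axiom_sound:
  assumes M: "is_jstit_model Ag M" and h: "h \<in> H (Le M) m"
    and "scheme_instance A" "agents A \<subseteq> Ag"
  shows "sat M m h A"
proof -
  note C = jstit_stit[OF M]
  note cell = cell_in_Choice[OF C _ h] cell_eq[OF C _ h]
  from assms(3,4) show ?thesis
  proof (cases rule: scheme_instance.cases)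
    case A0
    then show ?thesis using peval_sat unfolding tautology_def by metis
  next
    case (A3 jAs)
    have "fst ` set jAs \<subseteq> Ag"
      using \<open>agents A \<subseteq> Ag\<close> unfolding A3(1) by (fastforce simp: agents_Conj split: prod.splits)
    then show ?thesis
      using independence_sound[OF C h A3(2,3)] unfolding A3(1) by fastforce
  next
    case (A1_Stit_K j B D)
    then show ?thesis by auto
  next
    case (A1_Stit_T j B)
    then show ?thesis using cell(2)[of j] assms(4) by auto
  next
    case (A1_Stit_4 j B)
    then have "cell M m j h' = cell M m j h" if "h' \<in> cell M m j h" for h'
      using cell(4)[OF _ that] assms(4) by simp
    then show ?thesis unfolding A1_Stit_4 by auto
  next
    case (A1_Stit_5 j B)
    then have "cell M m j h' = cell M m j h" if "h' \<in> cell M m j h" for h'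
      using cell(4)[OF _ that] assms(4) by simp
    then show ?thesis unfolding A1_Stit_5 by auto
  next
    case (A2 B j)
    then have "cell M m j h \<subseteq> H (Le M) m"
      using cell(3)[of j] assms(4) by simp
    then show ?thesis unfolding A2 by auto
  next
    case (A4 s B D t)
    then show ?thesis using jstit_Evid_times[OF M] by auto
  next
    case (A5 t B)
    then show ?thesis
      using jstit_Evid_bang[OF M] jstit_Evid_mono[OF M] jstit_Re_trans[OF M] jstit_R_Re[OF M]
      by (simp; blast)
  next
    case (A6 s B t)
    then show ?thesis using jstit_Evid_plus[OF M] by auto
  next
    case (A7_4 B)
    then show ?thesis using jstit_R_trans[OF M] by (simp; blast)
  next
    case (A9 t)
    then show ?thesis using jstit_Act_all_mono[OF M] jstit_R_Re[OF M] unfolding Act_all_def by (simp; blast)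
  qed (use h jstit_R_refl[OF M] in auto)
qed

section \<open>Soundness in mixed successor frames\<close>

text \<open>
  This is all that soundness needs from mixed succession.  The moment \<open>m'\<close> is \<open>m\<close> itself if all
  histories through \<open>m\<close> are undivided or if \<open>m\<close> is maximal, and otherwise the immediate successor
  of \<open>m\<close> on \<open>h\<close>.
\<close>

lemma Act_eq_Act_all:
  assumes M: "is_jstit_model Ag M" and mix: "mixed_successor (Le M)" and h: "h \<in> H (Le M) m"
  shows "\<exists>m'. (m, m') \<in> Le M \<and> h \<in> H (Le M) m' \<and> Act_all M m' = Act M m h"
proof -
  note T = stit_temporal[OF jstit_stit[OF M]]
  consider (unbranched) "\<forall>g \<in> H (Le M) m. \<forall>g' \<in> H (Le M) m. undivided (Le M) m g g'"
    | (last) "\<nexists>m1. (m, m1) \<in> strict (Le M) \<and> m1 \<in> h"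
    | (succ) m1 where "(m, m1) \<in> strict (Le M)" "m1 \<in> h"
      "\<exists>m2. (m2, m1) \<in> Le M \<and> Next (Le M) m m2"
    using mix unfolding mixed_successor_def by blast
  then show ?thesis
  proof cases
    case unbranched
    then have "Act M m g = Act M m h" if "g \<in> H (Le M) m" for g
      using jstit_Act_undivided[OF M] that h by blast
    then have "Act_all M m = Act M m h" using h unfolding Act_all_def by blast
    then show ?thesis using h temporal_refl[OF T] by blast
  next
    case last
    then have maximal: "(m, b) \<notin> strict (Le M)" for b
      using history_proceeds[OF T _ h] by metis
    have sub: "g \<subseteq> g'" if "g \<in> H (Le M) m" "g' \<in> H (Le M) m" for g g'
    proof
      fix b assume "b \<in> g"
      then have "(b, m) \<in> Le M"
        using that history_comparable[OF T] maximal[of b] unfolding H_def strict_def by blast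
      then show "b \<in> g'"
        using that history_downward_closed[OF T] unfolding H_def by blast
    qed
    then have "H (Le M) m = {h}" using h by blast
    then have "Act_all M m = Act M m h" unfolding Act_all_def by simp
    then show ?thesis using h temporal_refl[OF T] by blast
  next
    case succ
    then obtain m2 where m2: "(m2, m1) \<in> Le M" "Next (Le M) m m2" by blast
    then have less: "(m, m2) \<in> strict (Le M)"
      and below: "\<And>a. (a, m2) \<in> strict (Le M) \<Longrightarrow> (a, m) \<in> Le M"
      unfolding Next_def by blast+
    have le: "(m, m2) \<in> Le M" using less unfolding strict_def by blast
    have h2: "h \<in> H (Le M) m2"
      using h succ(2) m2(1) history_downward_closed[OF T] unfolding H_def by blast
    have same: "Act M m g = Act M m h" if "g \<in> H (Le M) m2" for g
      using jstit_Act_undivided[OF M, of m g h] that h h2 less H_antimono[OF T le]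
      unfolding undivided_def by blast
    have "Act M m h \<subseteq> Act_all M m2"
      using same jstit_Act_mono[OF M le] unfolding Act_all_def by blast
    moreover have "Act_all M m2 \<subseteq> Act M m h"
    proof
      fix s assume "s \<in> Act_all M m2"
      then obtain a g where a: "(a, m2) \<in> strict (Le M)" "g \<in> H (Le M) m2" "s \<in> Act M a g"
        using jstit_Act_no_new[OF M] by blast
      then have "s \<in> Act M m g"
        using jstit_Act_mono[OF M below[OF a(1)] H_antimono[OF T le a(2)]] by blast
      then show "s \<in> Act M m h" using same[OF a(2)] by simp
    qed
    ultimately show ?thesis using le h2 by blast
  qed
qed

text \<open>
  What is known at \<open>m\<close> is still known at the later moment where \<open>Act_eq_Act_all\<close> finds the proofs of
  \<open>(m, h)\<close> as exactly those presented on all histories, so the premise can be applied there.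
\<close>

lemma RD_sound:
  assumes M: "is_jstit_model Ag M" and mix: "mixed_successor (Le M)"
    and prem: "valid_in M (\<^bold>K A \<^bold>\<rightarrow> Disj (map (\<lambda>t. \<^bold>\<not> \<^bold>\<box> \<^bold>E t) ts @ map (\<lambda>s. \<^bold>\<box> \<^bold>E s) ss))"
  shows "valid_in M (\<^bold>K A \<^bold>\<rightarrow> Disj (map (\<lambda>t. \<^bold>\<not> \<^bold>E t) ts @ map (\<lambda>s. \<^bold>E s) ss))"
proof -
  have "sat M m h (Disj (map (\<lambda>t. \<^bold>\<not> \<^bold>E t) ts @ map (\<lambda>s. \<^bold>E s) ss))"
    if h: "h \<in> H (Le M) m" and K: "sat M m h (\<^bold>K A)" for m h
  proof -
    obtain m' where m': "(m, m') \<in> Le M" "h \<in> H (Le M) m'" "Act_all M m' = Act M m h"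
      using Act_eq_Act_all[OF M mix h] by blast
    have "sat M m' h (\<^bold>K A)"
      using K jstit_R_trans[OF M jstit_Le_R[OF M m'(1)]] by auto
    moreover have "sat M m' h
        (\<^bold>K A \<^bold>\<rightarrow> Disj (map (\<lambda>t. \<^bold>\<not> \<^bold>\<box> \<^bold>E t) ts @ map (\<lambda>s. \<^bold>\<box> \<^bold>E s) ss))"
      using prem m'(2) unfolding valid_in_iff by blast
    ultimately have "sat M m' h (Disj (map (\<lambda>t. \<^bold>\<not> \<^bold>\<box> \<^bold>E t) ts @ map (\<lambda>s. \<^bold>\<box> \<^bold>E s) ss))"
      by simp
    then have "(\<exists>t \<in> set ts. t \<notin> Act_all M m') \<or> (\<exists>s \<in> set ss. s \<in> Act_all M m')"
      unfolding Act_all_def by (simp add: bex_Un)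
    then show ?thesis unfolding m'(3) by (simp add: bex_Un)
  qed
  then show ?thesis unfolding valid_in_iff by (simp only: sat.simps(2,3)) blast
qed

text \<open>Normality supplies the evidence for the outermost constant; the rest is a shorter chain.\<close>

lemma constant_specification_sound:
  assumes M: "is_jstit_model Ag M" and N: "normal CS M" and CS: "constant_specification Ag CS"
    and A: "A \<in> axioms Ag" and "consts_just cs A \<in> CS"
  shows "valid_in M (consts_just cs A)"
  using assms(5)
proof (induction cs)
  case Nil
  then show ?case
    using axiom_sound[OF M] A unfolding consts_just_def valid_in_iff axioms_def Form_def
    by auto
next
  case (Cons c cs)
  have "valid_in M (consts_just cs A)"
  proof (cases "cs = []")
    case True
    then show ?thesis
      using axiom_sound[OF M] A unfolding consts_just_def valid_in_iff axioms_def Form_def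
      by auto
  next
    case False
    then show ?thesis using Cons CS A unfolding constant_specification_def by blast
  qed
  moreover have "consts_just cs A \<in> Evid M m (PConst c)" for m
    using N Cons.prems unfolding normal_def consts_just_def by auto
  ultimately show ?case unfolding consts_just_def valid_in_iff by auto
qed

lemma provable_sound:
  assumes M: "is_jstit_model Ag M" and mix: "mixed_successor (Le M)"
    and N: "normal CS M" and CS: "constant_specification Ag CS"
    and "provable Ag CS A"
  shows "valid_in M A"
  using assms(5)
proof (induction rule: provable.induct)
  case (Ax A)
  then show ?case
    using axiom_sound[OF M] unfolding valid_in_iff axioms_def Form_def by auto
next
  case (R1 A B)
  then show ?case unfolding valid_in_iff by auto
next
  case (R2 A)
  then show ?case unfolding valid_in_iff by auto
next
  case (RD A ts ss)
  then show ?case using RD_sound[OF M mix] by blast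
next
  case (RCS A)
  then show ?case
    using constant_specification_sound[OF M N CS] CS unfolding constant_specification_def by blast
qed

section \<open>Refuting the rule without mixed successors\<close>

definition histories_towards :: "'m rel \<Rightarrow> 'm \<Rightarrow> 'm \<Rightarrow> 'm history set" where
  "histories_towards le m m1 = {h. \<exists>a \<in> h. (m, a) \<in> strict le \<and> (a, m1) \<in> le}"

text \<open>
  \<open>PVar 0\<close> and \<open>PVar 1\<close> are the proofs called \<open>t\<close> and \<open>s\<close> at the start: on the histories towards \<open>m1\<close>,
  the former is presented from \<open>m\<close> onwards and the latter strictly after \<open>m\<close>.
\<close>

definition counter_act :: "'m rel \<Rightarrow> 'm \<Rightarrow> 'm \<Rightarrow> 'm \<Rightarrow> 'm history \<Rightarrow> pol set" where
  "counter_act le m m1 a h =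
     {t. h \<in> histories_towards le m m1 \<and>
         (t = PVar 0 \<and> (m, a) \<in> le \<or> t = PVar 1 \<and> (m, a) \<in> strict le)}"

definition counter_model ::
  "'ag set \<Rightarrow> ('m, 'ag) stit_frame \<Rightarrow> 'm \<Rightarrow> 'm \<Rightarrow> ('m, 'ag) jstit_model" where
  "counter_model Ag C m m1 =
     \<lparr>Le = Le C, Choice = Choice C, R = Le C, Re = Le C, Act = counter_act (Le C) m m1,
      Evid = \<lambda>_ _. Form Ag, Val = \<lambda>_. {}\<rparr>"

lemma based_on_counter_model: "based_on (counter_model Ag C m m1) C"
  unfolding based_on_def counter_model_def stit_frame.truncate_def by simp

lemma normal_counter_model:
  assumes "constant_specification Ag CS"
  shows "normal CS (counter_model Ag C m m1)"
proof -
  have "A \<in> Form Ag" if "(PConst c \<^bold>: A) \<in> CS" for c A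
  proof -
    have "CS \<subseteq> {consts_just cs A | cs A. cs \<noteq> [] \<and> A \<in> axioms Ag}"
      using assms unfolding constant_specification_def by (elim conjE)
    from subsetD[OF this that] obtain cs B
      where B: "(PConst c \<^bold>: A) = consts_just cs B" "B \<in> Form Ag"
      unfolding axioms_def by auto
    have "agents (consts_just cs B) = agents B" for cs and B :: "'a fm"
      unfolding consts_just_def by (induction cs) auto
    then show ?thesis using B unfolding Form_def by (metis fm.set(6) mem_Collect_eq)
  qed
  then show ?thesis unfolding normal_def counter_model_def by auto
qed

text \<open>
  Of a moment \<open>b\<close> shared by \<open>h\<close> and \<open>g\<close> and a witness that \<open>h\<close> goes towards \<open>m1\<close>, the
  earlier one lies on \<open>g\<close> and witnesses the same for \<open>g\<close>.
\<close>

lemma undivided_towards: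
  assumes T: "is_temporal_frame le" and "(m, b) \<in> strict le" "h \<in> H le b" "g \<in> H le b"
    and h: "h \<in> histories_towards le m m1"
  shows "g \<in> histories_towards le m m1"
proof -
  obtain a where a: "a \<in> h" "(m, a) \<in> strict le" "(a, m1) \<in> le"
    using h unfolding histories_towards_def by blast
  have "(a, b) \<in> le \<or> (b, a) \<in> le"
    using history_comparable[OF T] a(1) assms(3) unfolding H_def by blast
  then show ?thesis
  proof
    assume "(a, b) \<in> le"
    then have "a \<in> g"
      using history_downward_closed[OF T] assms(4) unfolding H_def by blast
    then show ?thesis using a unfolding histories_towards_def by blast
  next
    assume "(b, a) \<in> le"
    then have "(b, m1) \<in> le" using temporal_trans[OF T _ a(3)] by blast
    then show ?thesis using assms(2,4) unfolding H_def histories_towards_def by blast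
  qed
qed

lemma all_towards_imp_undivided:
  assumes T: "is_temporal_frame le" and all: "H le m \<subseteq> histories_towards le m m1"
    and h: "h \<in> H le m" and g: "g \<in> H le m"
  shows "undivided le m h g"
proof -
  obtain a where a: "a \<in> h" "(m, a) \<in> strict le" "(a, m1) \<in> le"
    using h all unfolding histories_towards_def by blast
  obtain b where b: "b \<in> g" "(m, b) \<in> strict le" "(b, m1) \<in> le"
    using g all unfolding histories_towards_def by blast
  have "(a, b) \<in> le \<or> (b, a) \<in> le" using temporal_linear_below[OF T a(3) b(3)] .
  then show ?thesis
    using a b h g history_downward_closed[OF T] unfolding undivided_def H_def by blast
qed

text \<open>
  Density just after \<open>m\<close> in the direction of \<open>m1\<close>: \<open>b\<close> need not lie below \<open>m1\<close>, but it cannot be an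
  immediate successor of \<open>m\<close> either, being comparable with all moments of \<open>h\<close>, and these
  come arbitrarily close to \<open>m\<close>.
\<close>

lemma no_first_moment_towards:
  assumes T: "is_temporal_frame le"
    and dense: "\<And>a. (a, m1) \<in> le \<Longrightarrow> \<not> Next le m a"
    and b: "(m, b) \<in> strict le" "h \<in> H le b" and h: "h \<in> histories_towards le m m1"
  obtains c where "(m, c) \<in> strict le" "(c, b) \<in> strict le"
proof -
  obtain a where a: "a \<in> h" "(m, a) \<in> strict le" "(a, m1) \<in> le"
    using h unfolding histories_towards_def by blast
  have ab: "(a, b) \<in> le \<or> (b, a) \<in> le"
    using history_comparable[OF T] a(1) b(2) unfolding H_def by blast
  have split: "\<exists>c. (m, c) \<in> strict le \<and> (c, x) \<in> strict le"
    if "(m, x) \<in> strict le" "\<not> Next le m x" for x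
  proof -
    from that have "\<exists>c. (c, x) \<in> strict le \<and> (c, m) \<notin> le" unfolding Next_def by blast
    then obtain c where c: "(c, x) \<in> strict le" "(c, m) \<notin> le" by blast
    then have "(m, c) \<in> strict le"
      using temporal_linear_below[OF T, of m x c] that(1) temporal_refl[OF T]
      unfolding strict_def by blast
    with c(1) show ?thesis by blast
  qed
  show thesis
  proof (cases "(b, a) \<in> le")
    case True
    then have "\<not> Next le m b" using dense temporal_trans[OF T _ a(3)] by blast
    then show thesis using split[OF b(1)] that by blast
  next
    case False
    then have "(a, b) \<in> strict le" using ab temporal_refl[OF T] unfolding strict_def by blast
    then show thesis using a(2) that by blast
  qed
qed

lemma counter_model_is_jstit_model:
  assumes C: "is_stit_frame Ag C"
    and dense: "\<And>a. (a, m1) \<in> Le C \<Longrightarrow> \<not> Next (Le C) m a"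
    and branching: "\<not> H (Le C) m \<subseteq> histories_towards (Le C) m m1"
  shows "is_jstit_model Ag (counter_model Ag C m m1)"
proof -
  let ?le = "Le C"
  let ?M = "counter_model Ag C m m1"
  let ?S = "histories_towards ?le m m1"
  have T: "is_temporal_frame ?le" using C unfolding is_stit_frame_def by blast
  have strict_trans: "(a, c) \<in> strict ?le"
    if "(a, b) \<in> strict ?le" "(b, c) \<in> ?le" for a b c
    using that temporal_trans[OF T, of a b c] temporal_antisym[OF T, of a b]
    unfolding strict_def by blast
  have sels [simp]: "Le ?M = ?le" "Choice ?M = Choice C" "R ?M = ?le" "Re ?M = ?le"
    "Act ?M = counter_act ?le m m1" "Evid ?M = (\<lambda>_ _. Form Ag)" "Val ?M = (\<lambda>_. {})"
    unfolding counter_model_def by auto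
  have [simp]: "cell ?M = cell C" by (intro ext) (simp add: cell_def)
  have frame: "is_jstit_frame Ag ?M"
  proof -
    have "preorder_on UNIV ?le"
      using T unfolding is_temporal_frame_def partial_order_on_def by blast
    moreover have "is_stit_frame Ag ?M"
      using C unfolding is_stit_frame_def by simp
    ultimately show ?thesis unfolding is_jstit_frame_def by simp
  qed
  have mono: "counter_act ?le m m1 a h \<subseteq> counter_act ?le m m1 b h" if "(a, b) \<in> ?le" for a b h
    using that temporal_trans[OF T, of m a b] strict_trans[of m a b]
    unfolding counter_act_def by blast
  have no_new: "\<exists>a. (a, b) \<in> strict ?le \<and> (\<exists>h \<in> H ?le b. t \<in> counter_act ?le m m1 a h)"
    if t: "t \<in> Act_all ?M b" for b t
  proof -
    obtain h where h: "h \<in> H ?le b" using H_nonempty[OF T] by blast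
    have all: "t \<in> counter_act ?le m m1 b g" if "g \<in> H ?le b" for g
      using t that unfolding Act_all_def by simp
    then have "H ?le b \<subseteq> ?S" unfolding counter_act_def by blast
    \<comment> \<open>Proofs common to all histories occur only strictly after \<open>m\<close>, as some history at \<open>m\<close> has none.\<close>
    then have "b \<noteq> m" using branching by blast
    with all[OF h] have b: "(m, b) \<in> strict ?le"
      unfolding counter_act_def strict_def by blast
    have hS: "h \<in> ?S" using h \<open>H ?le b \<subseteq> ?S\<close> by blast
    obtain c where c: "(m, c) \<in> strict ?le" "(c, b) \<in> strict ?le"
      using no_first_moment_towards[OF T dense b h hS] by blast
    then have "t \<in> counter_act ?le m m1 c h"
      using all[OF h] unfolding counter_act_def strict_def by blast
    with c(2) h show ?thesis by blast
  qed
  have determined: "counter_act ?le m m1 a h = counter_act ?le m m1 a g"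
    if "undivided ?le a h g" for a h g
  proof (cases "(m, a) \<in> ?le")
    case True
    from that obtain b where b: "(a, b) \<in> strict ?le" "h \<in> H ?le b" "g \<in> H ?le b"
      unfolding undivided_def by blast
    have "(m, b) \<in> strict ?le"
      using True b(1) temporal_trans[OF T, of m a b] temporal_antisym[OF T, of m a]
      unfolding strict_def by blast
    then have "h \<in> ?S \<longleftrightarrow> g \<in> ?S" using undivided_towards[OF T] b(2,3) by blast
    then show ?thesis unfolding counter_act_def by blast
  next
    case False
    then show ?thesis unfolding counter_act_def strict_def by blast
  qed
  have "Act_all ?M a \<subseteq> Act_all ?M b" if "(a, b) \<in> ?le" for a b
    using mono[OF that] H_antimono[OF T that] unfolding Act_all_def by fastforce
  then have "\<forall>a b. (a, b) \<in> ?le \<longrightarrow> Act_all ?M a \<subseteq> Act_all ?M b" by blast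
  moreover have "\<forall>b a. (a, b) \<in> strict ?le \<longrightarrow>
      (\<forall>h \<in> H ?le b. counter_act ?le m m1 a h \<subseteq> counter_act ?le m m1 b h)"
    using mono unfolding strict_def by blast
  moreover have "\<forall>b. Act_all ?M b \<subseteq>
      (\<Union>a \<in> {a. (a, b) \<in> strict ?le}. \<Union>h \<in> H ?le b. counter_act ?le m m1 a h)"
    using no_new by blast
  moreover have "\<forall>a. \<forall>h \<in> H ?le a. \<forall>g \<in> H ?le a.
      undivided ?le a h g \<longrightarrow> counter_act ?le m m1 a h = counter_act ?le m m1 a g"
    using determined by blast
  ultimately show ?thesis
    unfolding is_jstit_model_def sels using frame by (simp add: Form_def)
qed

text \<open>
  The side formula of the rule is the very disjunction that it is to imply, so that the premise is
  an instance of reflexivity for \<open>K\<close>.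
\<close>

lemma provable_disjunction_without_box:
  "provable Ag CS (\<^bold>K (\<^bold>\<not> \<^bold>\<box> \<^bold>E t \<^bold>\<or> \<^bold>\<box> \<^bold>E s) \<^bold>\<rightarrow> (\<^bold>\<not> \<^bold>E t \<^bold>\<or> \<^bold>E s))"
proof -
  let ?A = "\<^bold>\<not> \<^bold>\<box> \<^bold>E t \<^bold>\<or> \<^bold>\<box> \<^bold>E s"
  have "provable Ag CS (\<^bold>K ?A \<^bold>\<rightarrow> ?A)"
    by (rule provable.Ax) (auto simp: axioms_def Form_def intro: A7_T)
  then have "provable Ag CS
      (\<^bold>K ?A \<^bold>\<rightarrow> Disj (map (\<lambda>t. \<^bold>\<not> \<^bold>\<box> \<^bold>E t) [t] @ map (\<lambda>s. \<^bold>\<box> \<^bold>E s) [s]))"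
    by simp
  from provable.RD[OF this] show ?thesis by simp
qed

lemma refute_disjunction_without_box:
  assumes T: "is_temporal_frame (Le C)" and m1: "(m, m1) \<in> strict (Le C)"
    and branching: "\<not> H (Le C) m \<subseteq> histories_towards (Le C) m m1"
  shows "\<not> valid_in (counter_model Ag C m m1)
           (\<^bold>K (\<^bold>\<not> \<^bold>\<box> \<^bold>E (PVar 0) \<^bold>\<or> \<^bold>\<box> \<^bold>E (PVar 1)) \<^bold>\<rightarrow> (\<^bold>\<not> \<^bold>E (PVar 0) \<^bold>\<or> \<^bold>E (PVar 1)))"
proof -
  let ?le = "Le C"
  let ?M = "counter_model Ag C m m1"
  have sels [simp]: "Le ?M = ?le" "R ?M = ?le" "Act ?M = counter_act ?le m m1"
    unfolding counter_model_def by auto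
  obtain g where g: "g \<in> H ?le m1" using H_nonempty[OF T] by blast
  then have gm: "g \<in> H ?le m" using H_antimono[OF T] m1 unfolding strict_def by blast
  have "g \<in> histories_towards ?le m m1"
    using g m1 temporal_refl[OF T] unfolding histories_towards_def H_def by blast
  then have "PVar 0 \<in> counter_act ?le m m1 m g" "PVar 1 \<notin> counter_act ?le m m1 m g"
    using temporal_refl[OF T] unfolding counter_act_def strict_def by auto
  moreover have "PVar 1 \<in> counter_act ?le m m1 a h'"
    if "\<forall>h \<in> H ?le a. PVar 0 \<in> counter_act ?le m m1 a h" "h' \<in> H ?le a" for a h'
  proof -
    have "a \<noteq> m" using that(1) branching unfolding counter_act_def by blast
    then show ?thesis using that unfolding counter_act_def strict_def by auto
  qed
  then have "sat ?M m g (\<^bold>K (\<^bold>\<not> \<^bold>\<box> \<^bold>E (PVar 0) \<^bold>\<or> \<^bold>\<box> \<^bold>E (PVar 1)))" by auto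
  ultimately have "\<not> sat ?M m g
      (\<^bold>K (\<^bold>\<not> \<^bold>\<box> \<^bold>E (PVar 0) \<^bold>\<or> \<^bold>\<box> \<^bold>E (PVar 1)) \<^bold>\<rightarrow> (\<^bold>\<not> \<^bold>E (PVar 0) \<^bold>\<or> \<^bold>E (PVar 1)))"
    by simp
  then show ?thesis using gm unfolding valid_in_iff by auto
qed

section \<open>The characterisation\<close>

theorem theorem2:
  fixes Ag :: "'ag set"
    and C :: "('m, 'ag) stit_frame"
    and CS :: "'ag fm set"
  assumes "finite Ag"
    and "is_stit_frame Ag C"
    and "constant_specification Ag CS"
  shows "(\<forall>M :: ('m, 'ag) jstit_model.
            is_jstit_model Ag M \<and> based_on M C \<and> normal CS M \<longrightarrow>
            (\<forall>A \<in> Form Ag. provable Ag CS A \<longrightarrow> valid_in M A))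
         \<longleftrightarrow> C \<in> mixsucc_frames Ag"
proof
  assume "C \<in> mixsucc_frames Ag"
  then have mix: "mixed_successor (Le C)" unfolding mixsucc_frames_def by blast
  have "Le M = Le C" if "based_on M C" for M :: "('m, 'ag) jstit_model"
    using that unfolding based_on_def stit_frame.truncate_def by auto
  with mix provable_sound assms(3)
  show "\<forall>M :: ('m, 'ag) jstit_model.
          is_jstit_model Ag M \<and> based_on M C \<and> normal CS M \<longrightarrow>
          (\<forall>A \<in> Form Ag. provable Ag CS A \<longrightarrow> valid_in M A)"
    by metis
next
  assume sound: "\<forall>M :: ('m, 'ag) jstit_model.
            is_jstit_model Ag M \<and> based_on M C \<and> normal CS M \<longrightarrow>
            (\<forall>A \<in> Form Ag. provable Ag CS A \<longrightarrow> valid_in M A)"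
  have T: "is_temporal_frame (Le C)" using assms(2) unfolding is_stit_frame_def by blast
  have "mixed_successor (Le C)"
  proof (rule ccontr)
    assume "\<not> mixed_successor (Le C)"
    then obtain m m1 h g where m1: "(m, m1) \<in> strict (Le C)"
      and dense: "\<And>a. (a, m1) \<in> Le C \<Longrightarrow> \<not> Next (Le C) m a"
      and hg: "h \<in> H (Le C) m" "g \<in> H (Le C) m" "\<not> undivided (Le C) m h g"
      unfolding mixed_successor_def by blast
    have branching: "\<not> H (Le C) m \<subseteq> histories_towards (Le C) m m1"
      using all_towards_imp_undivided[OF T _ hg(1,2)] hg(3) by blast
    let ?B = "\<^bold>K (\<^bold>\<not> \<^bold>\<box> \<^bold>E (PVar 0) \<^bold>\<or> \<^bold>\<box> \<^bold>E (PVar 1)) \<^bold>\<rightarrow> (\<^bold>\<not> \<^bold>E (PVar 0) \<^bold>\<or> \<^bold>E (PVar 1)) :: 'ag fm"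
    let ?M = "counter_model Ag C m m1"
    have "is_jstit_model Ag ?M"
      by (rule counter_model_is_jstit_model[OF assms(2) _ branching]) (rule dense)
    moreover have "based_on ?M C" "normal CS ?M"
      by (rule based_on_counter_model normal_counter_model[OF assms(3)])+
    moreover have "?B \<in> Form Ag" unfolding Form_def by simp
    ultimately have "valid_in ?M ?B"
      using sound provable_disjunction_without_box[of Ag CS "PVar 0" "PVar 1"] by blast
    then show False using refute_disjunction_without_box[OF T m1 branching] by blast
  qed
  then show "C \<in> mixsucc_frames Ag" using assms(2) unfolding mixsucc_frames_def by blast
qed

end
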